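(* Assume there are constants $K_{\partial\Omega,\Omega},L_{\partial\Omega,\Omega},K_1$ such that for all $f\in C^1(\Omega)$ $$\mathrm{Var}_{\sigma_\beta}(f)\le K_{\partial\Omega,\Omega}\int_\Omega|\nabla f|^2\,d\lambda_\alpha,\qquad\mathrm{Ent}_{\sigma_\beta}(f^2)\le L_{\partial\Omega,\Omega}\int_\Omega|\nabla f|^2\,d\lambda_\alpha,$$ $$\left(\int_\Omega f\,d\lambda_\alpha-\int_{\partial\Omega}f\,d\sigma_\beta\right)^2\le K_1\int_\Omega|\nabla f|^2\,d\lambda_\alpha .$$ Then $$\hat L_\mu\le L_{\lambda_\alpha}+\frac BA L_{\partial\Omega,\Omega}+B\,\frac{\ln B-\ln A}{B-A}\left(C_{\lambda_\alpha}+K_{\partial\Omega,\Omega}+K_1\right).$$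
   Context: Setting and notation. $\Omega$ is a smooth compact connected Riemannian manifold of dimension $d\ge2$ with smooth connected boundary $\partial\Omega$ (the boundary is included in $\Omega$). $\lambda$ is the volume measure on $\Omega$, $\sigma$ the Hausdorff (surface) measure on $\partial\Omega$, $\nabla$ the gradient on $\Omega$, $\nabla^\tau$ the tangential gradient on $\partial\Omega$. $C^1(\Omega)$ denotes functions that are $C^1$ up to the boundary; integrals over $\partial\Omega$ of functions on $\Omega$ use their restriction (trace). $\alpha,\beta:\Omega\to\mathbb{R}$ are weights, $A:=\int_\Omega\alpha\,d\lambda$, $B:=\int_{\partial\Omega}\beta\,d\sigma$, $d\lambda_\alpha:=\frac{\alpha}{A}d\lambda$, $d\sigma_\beta:=\frac{\beta}{B}d\sigma$, $d\mu:=\alpha\,d\lambda+\beta\,d\sigma$. For a probability measure $\nu$: $\mathrm{Var}_\nu(f)=\int f^2d\nu-(\int f\,d\nu)^2$ and $\mathrm{Ent}_\nu(f^2)=\int f^2\ln(f^2)d\nu-\int f^2d\nu\,\ln\int f^2d\nu$. Standing assumptions. (1) $\mu$ is a probability measure, with $A,B\in(0,1)$, $A+B=1$. (2) $\alpha,\beta\in C(\Omega)$, $\alpha>0$ $\lambda$-a.e. on $\Omega$, $\beta>0$ $\sigma$-a.e. on $\partial\Omega$, $\sqrt\alpha\in W^{1,2}(\Omega)$, $\sqrt\beta\in W^{1,2}(\partial\Omega)$ (the last condition is not used in the present case without boundary diffusion). (3) The constants $C_{\lambda_\alpha},L_{\lambda_\alpha},C_{\sigma_\beta},L_{\sigma_\beta}$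 are finite, where these are the smallest constants with $\mathrm{Var}_{\lambda_\alpha}(f)\le C_{\lambda_\alpha}\int_\Omega|\nabla f|^2d\lambda_\alpha$ and $\mathrm{Ent}_{\lambda_\alpha}(f^2)\le L_{\lambda_\alpha}\int_\Omega|\nabla f|^2d\lambda_\alpha$ for all $f\in C^1(\Omega)$, and $\mathrm{Var}_{\sigma_\beta}(f)\le C_{\sigma_\beta}\int_{\partial\Omega}|\nabla^\tau f|^2d\sigma_\beta$ and $\mathrm{Ent}_{\sigma_\beta}(f^2)\le L_{\sigma_\beta}\int_{\partial\Omega}|\nabla^\tau f|^2d\sigma_\beta$ for all $f\in C^1(\partial\Omega)$. (4) The following embeddings/traces hold: $W^{1,2}(\Omega,\alpha d\lambda)\to L^2(\Omega,\alpha d\lambda)$ compactly; $W^{1,2}(\Omega,\alpha d\lambda)\to L^p(\Omega,\beta d\lambda)$ for $p\in[2,\frac{2d-2}{d-2}]$; $W^{1,2}(\partial\Omega,\beta d\sigma)\to L^2(\partial\Omega,\beta d\sigma)$ compactly; the trace $W^{1,2}(\Omega,\alpha d\lambda)\to L^2(\partial\Omega,\beta d\sigma)$ compactly. $\hat L_\mu$ is the smallest constant such that $\mathrm{Ent}_\mu(f^2)\le\hat L_\mu\int_\Omega|\nabla f|^2\alpha\,d\lambda$ for all $f\in C^1(\Omega)$. If $A=B$, the quotient $\frac{\ln B-\ln A}{B-A}$ is read as its limit value $\frac1A=2$. *)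

theory Defs
  imports "HOL-Analysis.Analysis" "HOL-Probability.Probability_Measure"
begin

section \<open>Smooth Riemannian manifolds, possibly with boundary\<close>

text \<open>
  A Riemannian manifold is given by an atlas of triples \<open>(U, \<phi>, G)\<close>: a chart domain \<open>U\<close>, the
  coordinate map \<open>\<phi>\<close> on \<open>U\<close>, and the metric, \<open>G p v w\<close> being the inner product at \<open>p \<in> U\<close> of the
  tangent vectors with coordinates \<open>v\<close> and \<open>w\<close> in this chart. Only values of \<open>\<phi>\<close> and \<open>G\<close> on \<open>U\<close>
  matter. The model \<open>H\<close> is the half space for a manifold with boundary and \<open>UNIV\<close> for one without.
\<close>

type_synonym ('a, 'v) rchart = "'a set \<times> ('a \<Rightarrow> 'v) \<times> ('a \<Rightarrow> 'v \<Rightarrow> 'v \<Rightarrow> real)"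

definition points :: "('a, 'v) rchart set \<Rightarrow> 'a set" where
  "points \<A> = (\<Union>(U, \<phi>, G)\<in>\<A>. U)"

text \<open>
  Used only for sets \<open>S\<close> that are relatively open in the model, where derivatives within \<open>S\<close> are
  unique; at points of the bounding hyperplane this is \<open>C\<^sup>k\<close> regularity up to the boundary.
\<close>

primrec Ck_on :: "nat \<Rightarrow> ('v::real_normed_vector \<Rightarrow> 'w::real_normed_vector) \<Rightarrow> 'v set \<Rightarrow> bool" where
  "Ck_on 0 f S \<longleftrightarrow> continuous_on S f"
| "Ck_on (Suc k) f S \<longleftrightarrow>
     (\<exists>f'. (\<forall>x\<in>S. (f has_derivative f' x) (at x within S)) \<and> (\<forall>v. Ck_on k (\<lambda>x. f' x v) S))"

definition smooth_on :: "('v::real_normed_vector \<Rightarrow> 'w::real_normed_vector) \<Rightarrow> 'v set \<Rightarrow> bool" where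
  "smooth_on f S \<longleftrightarrow> (\<forall>k. Ck_on k f S)"

text \<open>
  Since \<open>DIM('b) \<ge> 1\<close>, the model \<open>real \<times> 'b\<close> has an arbitrary dimension \<open>d \<ge> 2\<close>, and the bounding
  hyperplane is a copy of \<open>'b\<close>, of dimension \<open>d - 1\<close>.
\<close>

definition half_space :: "(real \<times> 'b::euclidean_space) set" where
  "half_space = {x. 0 \<le> fst x}"

definition riemannian_chart ::
    "'v::euclidean_space set \<Rightarrow> 'a::topological_space set \<Rightarrow> ('a, 'v) rchart \<Rightarrow> bool" where
  "riemannian_chart H \<Omega> = (\<lambda>(U, \<phi>, G).
     openin (top_of_set \<Omega>) U \<and> openin (top_of_set H) (\<phi> ` U) \<and>
     homeomorphism U (\<phi> ` U) \<phi> (inv_into U \<phi>) \<and>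
     (\<forall>p\<in>U. bilinear (G p) \<and> (\<forall>v w. G p v w = G p w v) \<and> (\<forall>v. v \<noteq> 0 \<longrightarrow> 0 < G p v v)) \<and>
     (\<forall>v w. smooth_on (\<lambda>x. G (inv_into U \<phi> x) v w) (\<phi> ` U)))"

text \<open>Chart changes are smooth and carry one expression of the metric to the other.\<close>

definition compatible_charts ::
    "('a, 'v::euclidean_space) rchart \<Rightarrow> ('a, 'v) rchart \<Rightarrow> bool" where
  "compatible_charts = (\<lambda>(U, \<phi>, G) (V, \<psi>, K).
     smooth_on (\<lambda>x. \<psi> (inv_into U \<phi> x)) (\<phi> ` (U \<inter> V)) \<and>
     (\<forall>p\<in>U \<inter> V. \<forall>D.
        ((\<lambda>x. \<psi> (inv_into U \<phi> x)) has_derivative D) (at (\<phi> p) within \<phi> ` (U \<inter> V)) \<longrightarrow>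
        (\<forall>v w. G p v w = K p (D v) (D w))))"

definition riemannian_atlas ::
    "'v::euclidean_space set \<Rightarrow> ('a::topological_space, 'v) rchart set \<Rightarrow> bool" where
  "riemannian_atlas H \<A> \<longleftrightarrow>
     (\<forall>c\<in>\<A>. riemannian_chart H (points \<A>) c) \<and> (\<forall>c\<in>\<A>. \<forall>c'\<in>\<A>. compatible_charts c c')"

text \<open>
  The boundary, as a Riemannian manifold modelled on \<open>'b\<close> with the induced metric. Its points are
  those with first coordinate \<open>0\<close> in some (equivalently, every) chart around them.
\<close>

definition bdry ::
    "('a, real \<times> 'b::euclidean_space) rchart set \<Rightarrow> ('a, 'b) rchart set" where
  "bdry \<A> = (\<lambda>(U, \<phi>, G). ({p \<in> U. fst (\<phi> p) = 0}, \<lambda>p. snd (\<phi> p), \<lambda>p v w. G p (0, v) (0, w))) ` \<A>"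

text \<open>
  The tangent space at \<open>p\<close> is represented by \<open>'v\<close>, through the coordinates of one chosen chart.
\<close>

definition chart_at :: "('a, 'v) rchart set \<Rightarrow> 'a \<Rightarrow> ('a, 'v) rchart" where
  "chart_at \<A> p = (SOME c. c \<in> \<A> \<and> p \<in> fst c)"

definition metric_at :: "('a, 'v) rchart set \<Rightarrow> 'a \<Rightarrow> 'v \<Rightarrow> 'v \<Rightarrow> real" where
  "metric_at \<A> p = (case chart_at \<A> p of (U, \<phi>, G) \<Rightarrow> G p)"

definition C1 :: "('a, 'v::euclidean_space) rchart set \<Rightarrow> ('a \<Rightarrow> real) set" where
  "C1 \<A> = {f. \<forall>(U, \<phi>, G)\<in>\<A>. Ck_on 1 (\<lambda>x. f (inv_into U \<phi> x)) (\<phi> ` U)}"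

text \<open>The gradient represents the differential: \<open>df\<^sub>p(v) = \<langle>\<nabla>f(p), v\<rangle>\<^sub>p\<close>.\<close>

definition grad :: "('a, 'v::euclidean_space) rchart set \<Rightarrow> ('a \<Rightarrow> real) \<Rightarrow> 'a \<Rightarrow> 'v" where
  "grad \<A> f p = (case chart_at \<A> p of (U, \<phi>, G) \<Rightarrow>
     (THE u. ((\<lambda>x. f (inv_into U \<phi> x)) has_derivative (\<lambda>v. G p u v)) (at (\<phi> p) within \<phi> ` U)))"

definition grad_sq :: "('a, 'v::euclidean_space) rchart set \<Rightarrow> ('a \<Rightarrow> real) \<Rightarrow> 'a \<Rightarrow> real" where
  "grad_sq \<A> f p = metric_at \<A> p (grad \<A> f p) (grad \<A> f p)"


section \<open>Volume measure and Hausdorff measure\<close>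

text \<open>Leibniz formula for the determinant of the Gram matrix of \<open>g\<close> in the standard basis.\<close>

definition gram_det :: "('v::euclidean_space \<Rightarrow> 'v \<Rightarrow> real) \<Rightarrow> real" where
  "gram_det g = (\<Sum>\<pi> | \<pi> permutes Basis. of_int (sign \<pi>) * (\<Prod>b\<in>Basis. g b (\<pi> b)))"

text \<open>
  The volume measure, with density \<open>\<surd>det G\<close> in every chart. Since finitely many chart domains
  cover a compact manifold, it is determined uniquely.
\<close>

definition is_volume_measure ::
    "('a::topological_space, 'v::euclidean_space) rchart set \<Rightarrow> 'a measure \<Rightarrow> bool" where
  "is_volume_measure \<A> \<nu> \<longleftrightarrow>
     space \<nu> = points \<A> \<and> sets \<nu> = sets (restrict_space borel (points \<A>)) \<and>
     (\<forall>(U, \<phi>, G)\<in>\<A>. \<forall>E\<in>sets \<nu>. E \<subseteq> U \<longrightarrow>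
        emeasure \<nu> E = (\<integral>\<^sup>+x\<in>\<phi> ` E. ennreal (sqrt (gram_det (G (inv_into U \<phi> x)))) \<partial>lborel))"

text \<open>
  The Riemannian distance is the infimum of the lengths of piecewise \<open>C\<^sup>1\<close> curves. The
  velocity exists off a finite set of times, which has no influence on the length.
\<close>

definition curves ::
    "('a::topological_space, 'v::euclidean_space) rchart set \<Rightarrow> 'a \<Rightarrow> 'a \<Rightarrow> (real \<Rightarrow> 'a) set" where
  "curves \<A> p q = {\<gamma>. path \<gamma> \<and> path_image \<gamma> \<subseteq> points \<A> \<and> pathstart \<gamma> = p \<and> pathfinish \<gamma> = q \<and>
     (\<forall>(U, \<phi>, G)\<in>\<A>. \<forall>a b. 0 \<le> a \<and> a \<le> b \<and> b \<le> 1 \<and> \<gamma> ` {a..b} \<subseteq> U \<longrightarrow>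
        (\<lambda>t. \<phi> (\<gamma> t)) piecewise_C1_differentiable_on {a..b})}"

definition speed ::
    "('a, 'v::euclidean_space) rchart set \<Rightarrow> (real \<Rightarrow> 'a) \<Rightarrow> real \<Rightarrow> real" where
  "speed \<A> \<gamma> t = (case chart_at \<A> (\<gamma> t) of (U, \<phi>, G) \<Rightarrow>
     (let v = vector_derivative (\<lambda>s. \<phi> (\<gamma> s)) (at t) in sqrt (G (\<gamma> t) v v)))"

definition rdist ::
    "('a::topological_space, 'v::euclidean_space) rchart set \<Rightarrow> 'a \<Rightarrow> 'a \<Rightarrow> ennreal" where
  "rdist \<A> p q = (INF \<gamma>\<in>curves \<A> p q. \<integral>\<^sup>+t\<in>{0..1}. ennreal (speed \<A> \<gamma> t) \<partial>lborel)"

definition diam :: "('a \<Rightarrow> 'a \<Rightarrow> ennreal) \<Rightarrow> 'a set \<Rightarrow> ennreal" where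
  "diam \<rho> E = (SUP p\<in>E. SUP q\<in>E. \<rho> p q)"

text \<open>
  \<open>s\<close>-dimensional Hausdorff measure (for \<open>s > 0\<close>) on the Borel sets of \<open>X\<close>, with respect to the
  distance \<open>\<rho>\<close>, normalised so as to agree with Lebesgue measure on \<open>s\<close>-dimensional Euclidean space.
\<close>

definition hausdorff_pre ::
    "('a \<Rightarrow> 'a \<Rightarrow> ennreal) \<Rightarrow> nat \<Rightarrow> 'a set \<Rightarrow> ennreal \<Rightarrow> 'a set \<Rightarrow> ennreal" where
  "hausdorff_pre \<rho> s X \<delta> E =
     (INF C\<in>{C :: nat \<Rightarrow> 'a set. E \<subseteq> (\<Union>i. C i) \<and> (\<forall>i. C i \<subseteq> X \<and> diam \<rho> (C i) \<le> \<delta>)}.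
        \<Sum>i. ennreal (unit_ball_vol (real s) / 2 ^ s) * diam \<rho> (C i) ^ s)"

definition hausdorff_measure ::
    "('a \<Rightarrow> 'a \<Rightarrow> ennreal) \<Rightarrow> nat \<Rightarrow> 'a::topological_space set \<Rightarrow> 'a measure" where
  "hausdorff_measure \<rho> s X = measure_of X (sets (restrict_space borel X))
     (\<lambda>E. SUP \<delta>\<in>{0<..}. hausdorff_pre \<rho> s X \<delta> E)"

text \<open>
  Hausdorff measure on the boundary, in dimension one less than that of the model \<open>real \<times> 'b\<close>.
\<close>

definition surface_measure ::
    "('a::topological_space, real \<times> 'b::euclidean_space) rchart set \<Rightarrow> 'a measure" where
  "surface_measure \<A> = hausdorff_measure (rdist \<A>) DIM('b) (points (bdry \<A>))"

text \<open>The sum of a measure on a space and a measure on a subspace of it.\<close>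

definition plus_subspace_measure :: "'a measure \<Rightarrow> 'a measure \<Rightarrow> 'a measure" where
  "plus_subspace_measure M N = measure_of (space M) (sets M)
     (\<lambda>E. emeasure M E + emeasure N (E \<inter> space N))"


section \<open>Weighted Sobolev spaces\<close>

definition lp_norm :: "real \<Rightarrow> 'a measure \<Rightarrow> ('a \<Rightarrow> real) \<Rightarrow> ennreal" where
  "lp_norm p \<nu> f = (let I = (\<integral>\<^sup>+x. ennreal (\<bar>f x\<bar> powr p) \<partial>\<nu>) in
     if I = \<infinity> then \<infinity> else ennreal (enn2real I powr (1 / p)))"

text \<open>
  \<open>W\<^sup>1\<^sup>,\<^sup>2(\<nu>)\<close> is the completion of \<open>C\<^sup>1\<close> under \<open>(\<integral> f\<^sup>2 d\<nu> + \<integral> |\<nabla>f|\<^sup>2 d\<nu>)\<^sup>1\<^sup>/\<^sup>2\<close>: its elements are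
  the \<open>L\<^sup>2\<close> limits \<open>f\<close> of sequences of \<open>C\<^sup>1\<close> functions that are Cauchy for this norm, and the norm of
  \<open>f\<close> is the limit of the norms along the sequence. When the gradient is closable, as it is for a
  weight whose square root is in the unweighted space, that limit does not depend on the sequence,
  so the infimum in \<open>w12_norm\<close> runs over a single value.
\<close>

definition c1_norm ::
    "('a, 'v::euclidean_space) rchart set \<Rightarrow> 'a measure \<Rightarrow> ('a \<Rightarrow> real) \<Rightarrow> real" where
  "c1_norm \<A> \<nu> u = sqrt ((\<integral>p. (u p)\<^sup>2 \<partial>\<nu>) + (\<integral>p. grad_sq \<A> u p \<partial>\<nu>))"

definition w12_approx ::
    "('a, 'v::euclidean_space) rchart set \<Rightarrow> 'a measure \<Rightarrow> ('a \<Rightarrow> real) \<Rightarrow> (nat \<Rightarrow> 'a \<Rightarrow> real) \<Rightarrow> bool"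
  where
  "w12_approx \<A> \<nu> f u \<longleftrightarrow> (\<forall>n. u n \<in> C1 \<A>) \<and>
     (\<lambda>n. lp_norm 2 \<nu> (\<lambda>p. u n p - f p)) \<longlonglongrightarrow> 0 \<and>
     (\<forall>e>0. \<exists>N. \<forall>m\<ge>N. \<forall>n\<ge>N. c1_norm \<A> \<nu> (\<lambda>p. u m p - u n p) < e)"

definition W12 :: "('a, 'v::euclidean_space) rchart set \<Rightarrow> 'a measure \<Rightarrow> ('a \<Rightarrow> real) set" where
  "W12 \<A> \<nu> = {f \<in> borel_measurable \<nu>. \<exists>u. w12_approx \<A> \<nu> f u}"

definition w12_norm ::
    "('a, 'v::euclidean_space) rchart set \<Rightarrow> 'a measure \<Rightarrow> ('a \<Rightarrow> real) \<Rightarrow> real" where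
  "w12_norm \<A> \<nu> f = Inf {lim (\<lambda>n. c1_norm \<A> \<nu> (u n)) | u. w12_approx \<A> \<nu> f u}"

definition bounded_into ::
    "('a, 'v::euclidean_space) rchart set \<Rightarrow> 'a measure \<Rightarrow> real \<Rightarrow> 'a measure \<Rightarrow>
     (('a \<Rightarrow> real) \<Rightarrow> 'a \<Rightarrow> real) \<Rightarrow> bool" where
  "bounded_into \<A> \<nu> p \<tau> T \<longleftrightarrow> (\<exists>K. \<forall>f\<in>W12 \<A> \<nu>.
     T f \<in> borel_measurable \<tau> \<and> lp_norm p \<tau> (T f) \<le> ennreal (K * w12_norm \<A> \<nu> f))"

definition compact_into ::
    "('a, 'v::euclidean_space) rchart set \<Rightarrow> 'a measure \<Rightarrow> 'a measure \<Rightarrow>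
     (('a \<Rightarrow> real) \<Rightarrow> 'a \<Rightarrow> real) \<Rightarrow> bool" where
  "compact_into \<A> \<nu> \<tau> T \<longleftrightarrow> bounded_into \<A> \<nu> 2 \<tau> T \<and>
     (\<forall>F R. (\<forall>n::nat. F n \<in> W12 \<A> \<nu> \<and> w12_norm \<A> \<nu> (F n) \<le> R) \<longrightarrow>
        (\<exists>r h. strict_mono r \<and> h \<in> borel_measurable \<tau> \<and>
           (\<lambda>n. lp_norm 2 \<tau> (\<lambda>p. T (F (r n)) p - h p)) \<longlonglongrightarrow> 0))"

definition embeds ::
    "('a, 'v::euclidean_space) rchart set \<Rightarrow> 'a measure \<Rightarrow> real \<Rightarrow> 'a measure \<Rightarrow> bool" where
  "embeds \<A> \<nu> p \<tau> \<longleftrightarrow> bounded_into \<A> \<nu> p \<tau> (\<lambda>f. f)"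

definition compactly_embeds ::
    "('a, 'v::euclidean_space) rchart set \<Rightarrow> 'a measure \<Rightarrow> 'a measure \<Rightarrow> bool" where
  "compactly_embeds \<A> \<nu> \<tau> \<longleftrightarrow> compact_into \<A> \<nu> \<tau> (\<lambda>f. f)"

text \<open>\<open>T\<close> is the trace operator: the linear extension of restriction of \<open>C\<^sup>1\<close> functions.\<close>

definition compact_trace ::
    "('a, 'v::euclidean_space) rchart set \<Rightarrow> 'a measure \<Rightarrow> 'a measure \<Rightarrow> bool" where
  "compact_trace \<A> \<nu> \<tau> \<longleftrightarrow> (\<exists>T.
     (\<forall>u\<in>C1 \<A>. AE p in \<tau>. T u p = u p) \<and>
     (\<forall>f\<in>W12 \<A> \<nu>. \<forall>g\<in>W12 \<A> \<nu>. \<forall>a b.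
        AE p in \<tau>. T (\<lambda>q. a * f q + b * g q) p = a * T f p + b * T g p) \<and>
     compact_into \<A> \<nu> \<tau> T)"


section \<open>Variance, entropy and optimal constants\<close>

definition Var :: "'a measure \<Rightarrow> ('a \<Rightarrow> real) \<Rightarrow> real" where
  "Var \<nu> f = (\<integral>p. (f p)\<^sup>2 \<partial>\<nu>) - (\<integral>p. f p \<partial>\<nu>)\<^sup>2"

definition Ent :: "'a measure \<Rightarrow> ('a \<Rightarrow> real) \<Rightarrow> real" where
  "Ent \<nu> g = (\<integral>p. g p * ln (g p) \<partial>\<nu>) - (\<integral>p. g p \<partial>\<nu>) * ln (\<integral>p. g p \<partial>\<nu>)"

text \<open>
  Smallest constants for which the inequality holds on \<open>C\<^sup>1\<close>, with the energy taken with respect to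
  \<open>\<eta>\<close>. They are \<open>\<infinity>\<close> if there is no such real constant.
\<close>

definition poincare_const ::
    "('a, 'v::euclidean_space) rchart set \<Rightarrow> 'a measure \<Rightarrow> 'a measure \<Rightarrow> ereal" where
  "poincare_const \<A> \<nu> \<eta> =
     Inf {ereal c | c. \<forall>f\<in>C1 \<A>. Var \<nu> f \<le> c * (\<integral>p. grad_sq \<A> f p \<partial>\<eta>)}"

definition log_sobolev_const ::
    "('a, 'v::euclidean_space) rchart set \<Rightarrow> 'a measure \<Rightarrow> 'a measure \<Rightarrow> ereal" where
  "log_sobolev_const \<A> \<nu> \<eta> =
     Inf {ereal c | c. \<forall>f\<in>C1 \<A>. Ent \<nu> (\<lambda>p. (f p)\<^sup>2) \<le> c * (\<integral>p. grad_sq \<A> f p \<partial>\<eta>)}"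

definition log_quotient :: "real \<Rightarrow> real \<Rightarrow> real" where
  "log_quotient A B = (if A = B then 1 / A else (ln B - ln A) / (B - A))"

end

theory Submission
  imports Defs "HOL-Real_Asymp.Real_Asymp"
begin

text \<open>
  Write \<open>\<mu> = A lam\<alpha> + B \<sigma>\<beta>\<close> as a mixture of two probability measures. The entropy of \<open>f\<^sup>2\<close> splits
  accordingly (\<open>Ent_mixture\<close>): it is the average of the entropies of \<open>f\<^sup>2\<close> within the two components,
  plus the entropy of the function on two points of masses \<open>A\<close> and \<open>B\<close> whose values are the second
  moments \<open>a\<close> and \<open>b\<close> of \<open>f\<close> in the components. The first part is bounded by the logarithmic Sobolev
  inequality for \<open>lam\<alpha>\<close> and the assumed one for \<open>\<sigma>\<beta>\<close>.

  For the second part, the sharp logarithmic Sobolev inequality on two points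
  (\<open>two_point_log_sobolev\<close>) bounds the entropy by \<open>A B log_quotient A B (\<surd>a - \<surd>b)\<^sup>2\<close>. This is the source
  of the quotient of logarithms. Moreover \<open>(\<surd>a - \<surd>b)\<^sup>2\<close> is at most the sum of the two variances and
  the squared difference of the two means, because \<open>\<surd>a \<surd>b\<close> is at least the product of the means
  (\<open>sqrt_moment_diff_le\<close>). The three summands are bounded by the Poincare inequality for \<open>lam\<alpha>\<close> and by
  the assumptions with constants \<open>K\<^sub>b\<close> and \<open>K\<^sub>1\<close>. All bounds are multiples of the energy with respect
  to \<open>lam\<alpha>\<close>; passing to the density \<open>\<alpha>\<close> divides the constants by \<open>A\<close>.

  The two-point inequality is proved by a substitution. After normalisation it compares two
  Bernoulli distributions, and in terms of their logistic parameters \<open>s\<close> and \<open>t\<close> it says that the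
  function \<open>gap t\<close> is minimal at \<open>t\<close>. Its derivative has the sign of \<open>sinh s / s - sinh t / t\<close>
  for \<open>s > 0\<close>, and \<open>sinh s / s\<close> increases by convexity of \<open>sinh\<close>.

  Integrability is not an issue: \<open>f\<close> is continuous on a compact set, hence bounded.
\<close>

section \<open>The logarithmic Sobolev inequality on two points\<close>

text \<open>
  On the positive half line \<open>sinh\<close> is convex and vanishes at \<open>0\<close>, so its graph lies below the
  chord from the origin to \<open>(t, sinh t)\<close>.
\<close>

lemma sinh_star_shaped:
  fixes s t :: real
  assumes "0 \<le> s" "s \<le> t" "0 < t"
  shows "t * sinh s \<le> s * sinh t"
proof -
  have "convex_on {0..} (sinh :: real \<Rightarrow> real)"
    by (rule f''_ge0_imp_convex[where f' = cosh and f'' = sinh])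
       (auto intro!: derivative_eq_intros)
  then have "sinh ((1 - s / t) *\<^sub>R 0 + (s / t) *\<^sub>R t) \<le> (1 - s / t) * sinh 0 + (s / t) * sinh t"
    by (rule convex_onD) (use assms in auto)
  then show ?thesis using assms by (simp add: field_simps)
qed

text \<open>
  The reciprocal of \<open>sinh t / t\<close>, extended continuously to \<open>t = 0\<close>. The extension is what makes
  the case of equal masses no exception below.
\<close>

definition sinhc_inv :: "real \<Rightarrow> real" where
  "sinhc_inv t = (if t = 0 then 1 else t / sinh t)"

lemma sinhc_inv_minus [simp]: "sinhc_inv (- t) = sinhc_inv t"
  by (simp add: sinhc_inv_def)

lemma sinhc_inv_mult_sinh [simp]: "sinhc_inv t * sinh t = t"
  by (simp add: sinhc_inv_def)

text \<open>
  The line through the origin and \<open>(t, sinh t)\<close> has slope \<open>1 / sinhc_inv t\<close>: \<open>sinh\<close> is below it up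
  to \<open>t\<close> and above it afterwards. These two facts are the sign of the derivative of \<open>gap t\<close>.
\<close>

lemma sinhc_inv_sinh_le:
  assumes "0 \<le> s" "s \<le> t"
  shows "sinhc_inv t * sinh s \<le> s"
proof (cases "t = 0")
  case False
  then show ?thesis
    using sinh_star_shaped[OF assms] assms by (simp add: sinhc_inv_def field_simps)
qed (use assms in simp)

lemma sinhc_inv_sinh_ge:
  assumes "0 \<le> t" "t \<le> s"
  shows "s \<le> sinhc_inv t * sinh s"
proof (cases "t = 0")
  case True
  then show ?thesis
    using real_le_x_sinh[of s] assms by (simp add: sinhc_inv_def sinh_field_def exp_minus)
next
  case False
  then show ?thesis
    using sinh_star_shaped[of t s] assms by (simp add: sinhc_inv_def field_simps)
qed

text \<open>
  The Bernoulli distribution with masses \<open>u = e\<^sup>-\<^sup>s / (2 cosh s)\<close> and \<open>v = e\<^sup>s / (2 cosh s)\<close> has Shannon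
  entropy \<open>ln (2 cosh s) - s tanh s\<close>, and the geometric mean of its masses is \<open>1 / (2 cosh s)\<close>. Hence
  \<open>gap t s\<close> is the Shannon entropy minus a multiple of the geometric mean, the multiple being
  chosen so that \<open>s = t\<close> is a minimum.
\<close>

definition gap :: "real \<Rightarrow> real \<Rightarrow> real" where
  "gap t s = ln (2 * cosh s) - s * tanh s - sinhc_inv t / cosh s"

text \<open>
  The derivative of the entropy part is \<open>- s / cosh\<^sup>2 s\<close>, free of logarithms, which is the reason for
  using the logistic coordinate.
\<close>

lemma gap_deriv:
  "(gap t has_real_derivative (sinhc_inv t * sinh s - s) / (cosh s)\<^sup>2) (at s)"
proof -
  have c: "cosh s \<noteq> 0" "0 < cosh s" using cosh_real_pos[of s] by auto
  have sq: "1 - (tanh s)\<^sup>2 = 1 / (cosh s)\<^sup>2"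
    using c by (simp add: tanh_def power_divide sinh_square_eq diff_divide_distrib)
  have "((\<lambda>s. ln (2 * cosh s)) has_real_derivative tanh s) (at s)"
    using c by (auto intro!: derivative_eq_intros simp: tanh_def)
  moreover have "((\<lambda>s. s * tanh s) has_real_derivative tanh s + s / (cosh s)\<^sup>2) (at s)"
    using c by (auto intro!: derivative_eq_intros simp: sq)
  moreover have "((\<lambda>s. sinhc_inv t / cosh s) has_real_derivative
      - (sinhc_inv t * sinh s / (cosh s)\<^sup>2)) (at s)"
    using c by (auto intro!: derivative_eq_intros simp: power2_eq_square)
  ultimately have "((\<lambda>s. ln (2 * cosh s) - s * tanh s - sinhc_inv t / cosh s) has_real_derivative
      tanh s - (tanh s + s / (cosh s)\<^sup>2) - - (sinhc_inv t * sinh s / (cosh s)\<^sup>2)) (at s)"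
    by (intro DERIV_diff)
  then show ?thesis
    unfolding gap_def[abs_def] by (simp add: diff_divide_distrib)
qed

text \<open>
  Since \<open>gap\<close> is even in both arguments, only \<open>s, t \<ge> 0\<close> matter; there the derivative of \<open>gap t\<close>
  is nonpositive before \<open>t\<close> and nonnegative after it.
\<close>

lemma gap_minimal: "gap t t \<le> gap t s"
proof -
  have *: "gap t t \<le> gap t s" if "0 \<le> t" "0 \<le> s" for s t
  proof (cases "s \<le> t")
    case True
    show ?thesis
      by (rule DERIV_nonpos_imp_nonincreasing[OF True])
         (use gap_deriv sinhc_inv_sinh_le \<open>0 \<le> s\<close> in
           \<open>fastforce intro!: divide_nonpos_nonneg\<close>)
  next
    case False
    show ?thesis
      by (rule DERIV_nonneg_imp_nondecreasing[of t s])
         (use gap_deriv sinhc_inv_sinh_ge \<open>0 \<le> t\<close> False in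
           \<open>fastforce intro!: divide_nonneg_nonneg\<close>)+
  qed
  have ev: "gap t \<bar>s\<bar> = gap t s" "gap \<bar>t\<bar> s = gap t s" for s t
    by (auto simp: gap_def abs_if)
  from *[of "\<bar>t\<bar>" "\<bar>s\<bar>"] show ?thesis
    by (simp add: ev)
qed

text \<open>
  The entropy \<open>Ent\<close> of a function with value \<open>a\<close> on an atom of mass \<open>p\<close> and \<open>b\<close> on an atom of mass \<open>q\<close>,
  for \<open>p + q = 1\<close>.
\<close>

definition two_point_ent :: "real \<Rightarrow> real \<Rightarrow> real \<Rightarrow> real \<Rightarrow> real" where
  "two_point_ent p q a b = p * (a * ln a) + q * (b * ln b) - (p * a + q * b) * ln (p * a + q * b)"

text \<open>
  Half the log-odds \<open>ln (q / p)\<close> parametrises the Bernoulli distributions.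
\<close>

lemma logistic_coordinate:
  assumes "0 < p" "0 < q" "p + q = (1::real)"
  obtains t where "p = exp (- t) / (2 * cosh t)" "q = exp t / (2 * cosh t)"
proof -
  define t where "t = ln (q / p) / 2"
  have e: "exp t * exp t = q / p" using assms by (simp add: t_def flip: exp_add)
  have c: "exp (- t) * (exp t * exp t + 1) = 2 * cosh t"
    by (simp add: cosh_field_def distrib_left flip: exp_add)
  have "exp t * exp t + 1 = 1 / p"
    using assms(1) by (simp add: e assms(3)[symmetric] add_divide_distrib)
  with c have "exp (- t) / p = 2 * cosh t" by simp
  then have p: "p = exp (- t) / (2 * cosh t)"
    using assms by (simp add: nonzero_divide_eq_eq nonzero_eq_divide_eq mult.commute)
  have "q = exp t * exp t * p" using e assms by simp
  also have "\<dots> = (exp t * exp t * exp (- t)) / (2 * cosh t)" by (simp only: p times_divide_eq_right)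
  also have "exp t * exp t * exp (- t) = exp t" by (simp add: mult.assoc flip: exp_add)
  finally have q: "q = exp t / (2 * cosh t)" .
  from p q show thesis by (rule that)
qed

text \<open>
  With \<open>ln q - ln p = 2 t\<close> and \<open>q - p = tanh t\<close> the quotient is \<open>2 t / tanh t\<close>, and both conventions
  for the removable singularity give \<open>2\<close> at \<open>t = 0\<close>.
\<close>

lemma log_quotient_logistic:
  "log_quotient (exp (- t) / (2 * cosh t)) (exp t / (2 * cosh t)) = 2 * sinhc_inv t * cosh t"
proof (cases "t = 0")
  case False
  have "0 < cosh t" by simp
  have "exp t / (2 * cosh t) - exp (- t) / (2 * cosh t) = sinh t / cosh t"
    by (simp add: sinh_field_def diff_divide_distrib)
  moreover have "exp (- t) \<noteq> exp t" using False by simp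
  moreover have "ln (exp t / (2 * cosh t)) - ln (exp (- t) / (2 * cosh t)) = 2 * t"
    by (simp add: ln_div)
  ultimately show ?thesis
    using False \<open>0 < cosh t\<close> by (simp add: log_quotient_def sinhc_inv_def)
qed (simp add: log_quotient_def sinhc_inv_def)

text \<open>
  For a two-point function with mean \<open>1\<close>, entropy is the relative entropy of the tilted distribution
  \<open>(u, v)\<close> with respect to \<open>(p, q)\<close>. Both sides are elementary in the logistic coordinates \<open>s\<close> of
  \<open>(u, v)\<close> and \<open>t\<close> of \<open>(p, q)\<close>, and their difference is exactly \<open>gap t s - gap t t\<close>.
\<close>

lemma two_point_ent_logistic:
  fixes s t :: real
  defines "p \<equiv> exp (- t) / (2 * cosh t)" and "q \<equiv> exp t / (2 * cosh t)"
    and "u \<equiv> exp (- s) / (2 * cosh s)" and "v \<equiv> exp s / (2 * cosh s)"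
  shows "u * (ln u - ln p) + v * (ln v - ln q)
    \<le> log_quotient p q * (sqrt (q * u) - sqrt (p * v))\<^sup>2"
proof -
  define k where "k = sinhc_inv t"
  have c: "0 < cosh s" "0 < cosh t" by auto
  have kt: "k * sinh t = t" by (simp add: k_def)
  have uv: "u + v = 1" "v - u = tanh s"
    using c by (simp_all add: u_def v_def tanh_def cosh_field_def[of s] sinh_field_def[of s]
        add_divide_distrib[symmetric] diff_divide_distrib[symmetric])
  have "ln u - ln p = (t - s) + (ln (2 * cosh t) - ln (2 * cosh s))"
       "ln v - ln q = (s - t) + (ln (2 * cosh t) - ln (2 * cosh s))"
    by (simp_all add: p_def q_def u_def v_def ln_div)
  then have "u * (ln u - ln p) + v * (ln v - ln q)
      = (v - u) * (s - t) + (u + v) * (ln (2 * cosh t) - ln (2 * cosh s))"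
    by (simp only:) (simp only: algebra_simps)
  then have lhs: "u * (ln u - ln p) + v * (ln v - ln q)
      = (s - t) * tanh s + (ln (2 * cosh t) - ln (2 * cosh s))"
    by (simp add: uv)
  have nn: "0 \<le> q * u" "0 \<le> p * v"
    using c by (simp_all add: p_def q_def u_def v_def)
  \<comment> \<open>The square expands into a sum, which is a \<open>cosh\<close> of the difference, and a cross term.\<close>
  have "q * u * (p * v) = (1 / (4 * cosh s * cosh t))\<^sup>2"
    using c by (simp add: p_def q_def u_def v_def exp_minus field_simps power2_eq_square)
  then have "sqrt (q * u) * sqrt (p * v) = 1 / (4 * cosh s * cosh t)"
    using c by (simp flip: real_sqrt_mult)
  moreover have "q * u + p * v = cosh (t - s) / (2 * cosh s * cosh t)"
    using c by (simp add: p_def q_def u_def v_def cosh_field_def[of "t - s"] field_simps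
        flip: exp_add)
  ultimately have "(sqrt (q * u) - sqrt (p * v))\<^sup>2 = (cosh (t - s) - 1) / (2 * cosh s * cosh t)"
    using nn by (simp add: power2_diff diff_divide_distrib)
  then have "log_quotient p q * (sqrt (q * u) - sqrt (p * v))\<^sup>2 = k * (cosh (t - s) - 1) / cosh s"
    using c by (simp add: p_def q_def log_quotient_logistic k_def)
  also have "\<dots> = k * cosh t - (k * sinh t) * tanh s - k / cosh s"
    using c by (simp add: cosh_diff tanh_def field_simps)
  finally have rhs: "log_quotient p q * (sqrt (q * u) - sqrt (p * v))\<^sup>2
      = k * cosh t - t * tanh s - k / cosh s"
    by (simp only: kt)
  \<comment> \<open>The remaining terms, which do not involve \<open>s\<close>, combine to \<open>gap t t\<close> by \<open>cosh\<^sup>2 - sinh\<^sup>2 = 1\<close>.\<close>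
  have "k * (cosh t * cosh t) = t * sinh t + k"
    using cosh_square_eq[of t] kt by (simp add: power2_eq_square algebra_simps)
  then have "gap t t = ln (2 * cosh t) - k * cosh t"
    using c by (simp add: gap_def tanh_def k_def[symmetric] field_simps)
  with gap_minimal[of t s] show ?thesis
    unfolding lhs rhs gap_def[of t s] k_def[symmetric] left_diff_distrib by linarith
qed

text \<open>
  Both sides are homogeneous of degree one in \<open>(a, b)\<close>, so one may divide by the mean and read
  \<open>(p a, q b)\<close> as a probability distribution.
\<close>

lemma two_point_log_sobolev_pos:
  assumes "0 < p" "0 < q" "p + q = 1" "0 < a" "0 < b"
  shows "two_point_ent p q a b \<le> p * q * log_quotient p q * (sqrt a - sqrt b)\<^sup>2"
proof -
  define m where "m = p * a + q * b"
  define u v where "u = p * a / m" and "v = q * b / m"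
  have m: "0 < m" using assms by (simp add: m_def add_pos_pos)
  have "u + v = 1" using m by (simp add: u_def v_def m_def flip: add_divide_distrib)
  moreover have "0 < u" "0 < v" using m assms by (simp_all add: u_def v_def)
  ultimately have main: "u * (ln u - ln p) + v * (ln v - ln q)
      \<le> log_quotient p q * (sqrt (q * u) - sqrt (p * v))\<^sup>2"
    using assms two_point_ent_logistic
    by (metis logistic_coordinate)
  have ln: "ln u - ln p = ln a - ln m" "ln v - ln q = ln b - ln m"
    using assms m by (simp_all add: u_def v_def ln_div ln_mult)
  have "m * (u * (ln u - ln p) + v * (ln v - ln q)) = p * a * (ln a - ln m) + q * b * (ln b - ln m)"
    unfolding ln using m by (simp add: u_def v_def field_simps)
  also have "\<dots> = two_point_ent p q a b"
    by (simp add: two_point_ent_def m_def algebra_simps)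
  finally have lhs: "two_point_ent p q a b = m * (u * (ln u - ln p) + v * (ln v - ln q))" by simp
  have "q * u = p * q / m * a" "p * v = p * q / m * b"
    by (simp_all add: u_def v_def)
  then have "sqrt (q * u) - sqrt (p * v) = sqrt (p * q / m) * (sqrt a - sqrt b)"
    by (simp only: real_sqrt_mult right_diff_distrib)
  then have "m * (sqrt (q * u) - sqrt (p * v))\<^sup>2 = p * q * (sqrt a - sqrt b)\<^sup>2"
    using m assms by (simp add: power_mult_distrib)
  then have "m * (log_quotient p q * (sqrt (q * u) - sqrt (p * v))\<^sup>2)
      = p * q * log_quotient p q * (sqrt a - sqrt b)\<^sup>2"
    by (simp add: mult.left_commute)
  with mult_left_mono[OF main less_imp_le[OF m]] show ?thesis
    unfolding lhs by simp
qed

lemma tendsto_mult_ln_at_right_0: "((\<lambda>x::real. x * ln x) \<longlongrightarrow> 0) (at_right 0)"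
  by real_asymp

text \<open>
  A vanishing value corresponds to \<open>s = \<infinity>\<close> in the logistic coordinate; it is reached by continuity.
\<close>

lemma two_point_log_sobolev_zero:
  assumes "0 < p" "0 < q" "p + q = 1" "0 < b"
  shows "two_point_ent p q 0 b \<le> p * q * log_quotient p q * (sqrt 0 - sqrt b)\<^sup>2"
proof (rule tendsto_le[OF trivial_limit_at_right_real])
  show "((\<lambda>a. two_point_ent p q a b) \<longlongrightarrow> two_point_ent p q 0 b) (at_right 0)"
  proof -
    have "((\<lambda>a. p * a + q * b) \<longlongrightarrow> p * 0 + q * b) (at_right 0)"
      by (intro tendsto_intros)
    moreover have "((\<lambda>a. ln (p * a + q * b)) \<longlongrightarrow> ln (p * 0 + q * b)) (at_right 0)"
      by (intro tendsto_intros) (use assms in simp)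
    ultimately have "((\<lambda>a. p * (a * ln a) + q * (b * ln b) - (p * a + q * b) * ln (p * a + q * b))
        \<longlongrightarrow> p * 0 + q * (b * ln b) - (p * 0 + q * b) * ln (p * 0 + q * b)) (at_right 0)"
      by (intro tendsto_diff tendsto_add[OF tendsto_mult_left[OF tendsto_mult_ln_at_right_0]]
          tendsto_const tendsto_mult)
    then show ?thesis by (simp add: two_point_ent_def)
  qed
  show "((\<lambda>a. p * q * log_quotient p q * (sqrt a - sqrt b)\<^sup>2) \<longlongrightarrow>
      p * q * log_quotient p q * (sqrt 0 - sqrt b)\<^sup>2) (at_right 0)"
    by (intro tendsto_intros)
  show "\<forall>\<^sub>F a in at_right 0. two_point_ent p q a b
      \<le> p * q * log_quotient p q * (sqrt a - sqrt b)\<^sup>2"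
    using two_point_log_sobolev_pos assms by (auto simp: eventually_at_filter)
qed

lemma log_quotient_commute: "log_quotient p q = log_quotient q p"
  by (auto simp: log_quotient_def divide_simps) (auto simp: algebra_simps)

text \<open>
  The sharp logarithmic Sobolev inequality on two points. The factor \<open>p q log_quotient p q\<close> is the
  best constant: for \<open>p \<noteq> q\<close> there is equality when \<open>p a : q b = q : p\<close>.
\<close>

lemma two_point_log_sobolev:
  assumes "0 < p" "0 < q" "p + q = 1" "0 \<le> a" "0 \<le> b"
  shows "two_point_ent p q a b \<le> p * q * log_quotient p q * (sqrt a - sqrt b)\<^sup>2"
proof -
  consider "0 < a" "0 < b" | "a = 0" "0 < b" | "0 < a" "b = 0" | "a = 0" "b = 0"
    using assms by linarith
  then show ?thesis
  proof cases
    case 3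
    have "two_point_ent p q a b = two_point_ent q p 0 a"
      using 3 by (simp add: two_point_ent_def)
    also have "\<dots> \<le> q * p * log_quotient q p * (sqrt 0 - sqrt a)\<^sup>2"
      using two_point_log_sobolev_zero 3 assms by (simp add: add.commute)
    finally show ?thesis
      using 3 log_quotient_commute[of p q] by (simp add: mult.commute)
  qed (use assms two_point_log_sobolev_pos two_point_log_sobolev_zero in
        \<open>auto simp: two_point_ent_def\<close>)
qed

lemma log_quotient_pos:
  assumes "0 < p" "0 < q"
  shows "0 < log_quotient p q"
  using assms by (cases p q rule: linorder_cases) (auto simp: log_quotient_def divide_neg_neg)

section \<open>Entropy of a mixture\<close>

text \<open>
  With \<open>a, b\<close> second moments and \<open>m, n\<close> means, the right-hand side is \<open>a + b - 2 m n\<close>, and \<open>\<bar>m\<bar> \<le> \<surd>a\<close>,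
  \<open>\<bar>n\<bar> \<le> \<surd>b\<close>. In other words, it is the mean square of \<open>f(x) - f(y)\<close> for independent \<open>x\<close> and \<open>y\<close>, and the
  inequality is the reverse triangle inequality for the norm of \<open>L\<^sup>2\<close>.
\<close>

lemma sqrt_moment_diff_le:
  fixes a b m n :: real
  assumes "m\<^sup>2 \<le> a" "n\<^sup>2 \<le> b"
  shows "(sqrt a - sqrt b)\<^sup>2 \<le> (a - m\<^sup>2) + (b - n\<^sup>2) + (m - n)\<^sup>2"
proof -
  have nn: "0 \<le> a" "0 \<le> b" using assms zero_le_power2 by (meson order_trans)+
  have "m * n \<le> \<bar>m\<bar> * \<bar>n\<bar>" by (simp flip: abs_mult)
  also have "\<dots> \<le> sqrt a * sqrt b"
    by (intro mult_mono) (use assms nn real_le_rsqrt in auto)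
  finally show ?thesis using nn by (simp add: power2_diff)
qed

lemma sqrt_second_moment_diff_le:
  fixes f :: "'a \<Rightarrow> real"
  assumes M: "prob_space M" "integrable M f" "integrable M (\<lambda>x. (f x)\<^sup>2)"
    and N: "prob_space N" "integrable N f" "integrable N (\<lambda>x. (f x)\<^sup>2)"
  shows "(sqrt (\<integral>x. (f x)\<^sup>2 \<partial>M) - sqrt (\<integral>x. (f x)\<^sup>2 \<partial>N))\<^sup>2
    \<le> Var M f + Var N f + ((\<integral>x. f x \<partial>M) - (\<integral>x. f x \<partial>N))\<^sup>2"
proof -
  have "(\<integral>x. f x \<partial>L)\<^sup>2 \<le> (\<integral>x. (f x)\<^sup>2 \<partial>L)"
    if "prob_space L" "integrable L f" "integrable L (\<lambda>x. (f x)\<^sup>2)" for L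
    using prob_space.variance_positive[OF that(1), of f] prob_space.variance_eq[OF that] by simp
  from sqrt_moment_diff_le[OF this[OF M] this[OF N]] show ?thesis
    by (simp add: Var_def)
qed

text \<open>
  Makes \<open>f\<^sup>2 ln f\<^sup>2\<close> bounded when \<open>f\<close> is; \<open>x ln x\<close> is \<open>0\<close> at \<open>x = 0\<close> because \<open>ln 0 = 0\<close>.
\<close>

lemma abs_mult_ln_le:
  fixes x C :: real
  assumes "0 \<le> x" "x \<le> C"
  shows "\<bar>x * ln x\<bar> \<le> 1 + C\<^sup>2"
proof -
  consider "x = 0" | "0 < x" "x < 1" | "1 \<le> x" using assms by linarith
  then show ?thesis
  proof cases
    case 2
    have "- ln x \<le> 1 / x - 1" using 2 ln_le_minus_one[of "1 / x"] by (simp add: ln_div)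
    then have "x * - ln x \<le> x * (1 / x - 1)" using 2 by (intro mult_left_mono) auto
    also have "\<dots> \<le> 1" using 2 by (simp add: right_diff_distrib)
    also have "1 \<le> 1 + C\<^sup>2" by simp
    finally show ?thesis using 2 by (simp add: abs_mult)
  next
    case 3
    have "x * ln x \<le> x * x" using 3 ln_le_minus_one[of x] by (intro mult_left_mono) auto
    also have "\<dots> \<le> C\<^sup>2" unfolding power2_eq_square using 3 assms by (intro mult_mono) auto
    finally show ?thesis using 3 by (simp add: abs_mult)
  qed simp
qed

text \<open>
  The chain rule for entropy: the two-point term is the entropy of the conditional means of \<open>g\<close>
  given the component from which the point is drawn.
\<close>

lemma Ent_mixture:
  assumes "(\<integral>x. g x \<partial>\<mu>) = A * (\<integral>x. g x \<partial>M) + B * (\<integral>x. g x \<partial>N)"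
    and "(\<integral>x. g x * ln (g x) \<partial>\<mu>) = A * (\<integral>x. g x * ln (g x) \<partial>M) + B * (\<integral>x. g x * ln (g x) \<partial>N)"
  shows "Ent \<mu> g = A * Ent M g + B * Ent N g + two_point_ent A B (\<integral>x. g x \<partial>M) (\<integral>x. g x \<partial>N)"
  by (simp add: Ent_def two_point_ent_def assms algebra_simps)

text \<open>
  The two-point term of the chain rule involves only the norms of \<open>f\<close> in the two components, and the
  difference of these norms is controlled by the variances and the difference of the means.
  Boundedness of \<open>f\<close> serves to make the three integrands integrable.
\<close>

lemma log_sobolev_mixture:
  fixes f :: "'a \<Rightarrow> real"
  assumes M: "prob_space M" and N: "prob_space N"
    and AB: "0 < A" "0 < B" "A + B = 1"
    and f: "f \<in> borel_measurable M" "f \<in> borel_measurable N"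
    and bounded: "\<And>x. x \<in> space M \<union> space N \<Longrightarrow> \<bar>f x\<bar> \<le> C"
    and mixture: "\<And>g :: 'a \<Rightarrow> real. integrable M g \<Longrightarrow> integrable N g \<Longrightarrow>
      (\<integral>x. g x \<partial>\<mu>) = A * (\<integral>x. g x \<partial>M) + B * (\<integral>x. g x \<partial>N)"
  shows "Ent \<mu> (\<lambda>x. (f x)\<^sup>2) \<le> A * Ent M (\<lambda>x. (f x)\<^sup>2) + B * Ent N (\<lambda>x. (f x)\<^sup>2)
    + A * B * log_quotient A B * (Var M f + Var N f + ((\<integral>x. f x \<partial>M) - (\<integral>x. f x \<partial>N))\<^sup>2)"
proof -
  have int: "integrable L f" "integrable L (\<lambda>x. (f x)\<^sup>2)"
      "integrable L (\<lambda>x. (f x)\<^sup>2 * ln ((f x)\<^sup>2))"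
    if L: "prob_space L" "f \<in> borel_measurable L" "space L \<subseteq> space M \<union> space N" for L
  proof -
    interpret prob_space L by fact
    note [measurable] = L(2)
    have b: "\<bar>f x\<bar> \<le> C" if "x \<in> space L" for x using that L(3) bounded by blast
    have b2: "(f x)\<^sup>2 \<le> C\<^sup>2" if "x \<in> space L" for x
      using b[OF that] by (metis abs_le_square_iff abs_of_nonneg abs_ge_zero order_trans)
    show "integrable L f" by (rule integrable_const_bound[of _ C]) (use b in auto)
    show "integrable L (\<lambda>x. (f x)\<^sup>2)" by (rule integrable_const_bound[of _ "C\<^sup>2"]) (use b2 in auto)
    show "integrable L (\<lambda>x. (f x)\<^sup>2 * ln ((f x)\<^sup>2))"
    proof (rule integrable_const_bound[of _ "1 + (C\<^sup>2)\<^sup>2"])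
      show "AE x in L. norm ((f x)\<^sup>2 * ln ((f x)\<^sup>2)) \<le> 1 + (C\<^sup>2)\<^sup>2"
        using abs_mult_ln_le[OF zero_le_power2 b2] by (intro AE_I2) (simp only: real_norm_def)
    qed measurable
  qed
  note iM = int[OF M f(1) Un_upper1] and iN = int[OF N f(2) Un_upper2]
  let ?a = "\<integral>x. (f x)\<^sup>2 \<partial>M" and ?b = "\<integral>x. (f x)\<^sup>2 \<partial>N"
  have "two_point_ent A B ?a ?b \<le> A * B * log_quotient A B * (sqrt ?a - sqrt ?b)\<^sup>2"
    by (intro two_point_log_sobolev AB) simp_all
  also have "\<dots> \<le> A * B * log_quotient A B
      * (Var M f + Var N f + ((\<integral>x. f x \<partial>M) - (\<integral>x. f x \<partial>N))\<^sup>2)"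
    using AB log_quotient_pos[of A B]
    by (intro mult_left_mono sqrt_second_moment_diff_le M N iM iN) auto
  finally show ?thesis
    using Ent_mixture[OF mixture[OF iM(2) iN(2)] mixture[OF iM(3) iN(3)]] by simp
qed

section \<open>Sums and normalisations of measures\<close>

lemma space_plus_subspace_measure [simp]: "space (plus_subspace_measure M N) = space M"
  and sets_plus_subspace_measure [simp]: "sets (plus_subspace_measure M N) = sets M"
  by (simp_all add: plus_subspace_measure_def)

lemma measurable_plus_subspace_measure [simp]:
  "measurable (plus_subspace_measure M N) L = measurable M L"
  by (rule measurable_cong_sets) simp_all

text \<open>
  The constant \<open>measure_of\<close> yields the zero measure for a set function that is not countably
  additive; countable additivity on \<open>M\<close> is inherited from both summands.
\<close>

lemma emeasure_plus_subspace_measure: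
  fixes M N :: "'a measure"
  assumes sub: "\<And>E. E \<in> sets M \<Longrightarrow> E \<inter> space N \<in> sets N" and E: "E \<in> sets M"
  shows "emeasure (plus_subspace_measure M N) E = emeasure M E + emeasure N (E \<inter> space N)"
proof -
  have "countably_additive (sets M) (\<lambda>E. emeasure M E + emeasure N (E \<inter> space N))"
  proof (rule countably_additiveI)
    fix F :: "nat \<Rightarrow> 'a set"
    assume F: "range F \<subseteq> sets M" "disjoint_family F" "\<Union> (range F) \<in> sets M"
    have N: "range (\<lambda>i. F i \<inter> space N) \<subseteq> sets N" using F(1) sub by auto
    have "disjoint_family (\<lambda>i. F i \<inter> space N)" using F(2) by (auto simp: disjoint_family_on_def)
    from suminf_emeasure[OF N this]
    have *: "(\<Sum>i. emeasure N (F i \<inter> space N)) = emeasure N (\<Union> (range F) \<inter> space N)"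
      by (simp only: UN_extend_simps)
    have "(\<Sum>i. emeasure M (F i) + emeasure N (F i \<inter> space N)) =
        (\<Sum>i. emeasure M (F i)) + (\<Sum>i. emeasure N (F i \<inter> space N))"
      by (rule suminf_add[symmetric]) auto
    also have "\<dots> = emeasure M (\<Union> (range F)) + emeasure N (\<Union> (range F) \<inter> space N)"
      by (simp only: * suminf_emeasure[OF F(1,2)])
    finally show "(\<Sum>i. emeasure M (F i) + emeasure N (F i \<inter> space N)) =
        emeasure M (\<Union> (range F)) + emeasure N (\<Union> (range F) \<inter> space N)" .
  qed
  then show ?thesis
    unfolding plus_subspace_measure_def
    by (intro emeasure_measure_of_sigma)
       (auto simp: positive_def E intro: sets.sigma_algebra_axioms)
qed

context
  fixes M N :: "'a measure"
  assumes sp: "space N \<subseteq> space M"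
    and sub: "\<And>E. E \<in> sets M \<Longrightarrow> E \<inter> space N \<in> sets N"
begin

lemma measurable_subspace:
  assumes "f \<in> borel_measurable M"
  shows "f \<in> borel_measurable N"
proof (rule measurableI)
  fix S :: "'b set" assume "S \<in> sets borel"
  then have "f -` S \<inter> space M \<inter> space N \<in> sets N"
    using sub measurable_sets[OF assms] by blast
  moreover have "f -` S \<inter> space M \<inter> space N = f -` S \<inter> space N" using sp by blast
  ultimately show "f -` S \<inter> space N \<in> sets N" by simp
qed simp

lemma nn_integral_plus_subspace_measure:
  assumes "f \<in> borel_measurable M"
  shows "nn_integral (plus_subspace_measure M N) f = nn_integral M f + nn_integral N f"
  using assms
proof (induction f rule: borel_measurable_induct)
  case (cong f g)
  then have "\<And>x. x \<in> space N \<Longrightarrow> f x = g x" using sp by auto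
  with cong show ?case
    using nn_integral_cong[of N f g] nn_integral_cong[of M f g]
      nn_integral_cong[of "plus_subspace_measure M N" f g] by simp
next
  case (set E)
  have "(\<integral>\<^sup>+x. indicator E x \<partial>N) = (\<integral>\<^sup>+x. indicator (E \<inter> space N) x \<partial>N)"
    by (rule nn_integral_cong) (simp add: indicator_def)
  also have "\<dots> = emeasure N (E \<inter> space N)" using sub[OF set] by simp
  finally show ?case using set by (simp add: sub emeasure_plus_subspace_measure)
next
  case (mult u c)
  have u: "u \<in> borel_measurable M" "u \<in> borel_measurable N"
    by (rule mult.hyps(2), rule measurable_subspace[OF mult.hyps(2)])
  have IH: "nn_integral (plus_subspace_measure M N) u = nn_integral M u + nn_integral N u"
    by (rule mult.IH)
  show ?case
    by (simp only: nn_integral_cmult measurable_plus_subspace_measure u IH distrib_left)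
next
  case (add u v)
  have uv: "u \<in> borel_measurable M" "u \<in> borel_measurable N"
    "v \<in> borel_measurable M" "v \<in> borel_measurable N"
    by (rule add.hyps(1) add.hyps(3) measurable_subspace[OF add.hyps(1)]
        measurable_subspace[OF add.hyps(3)])+
  have IH: "nn_integral (plus_subspace_measure M N) u = nn_integral M u + nn_integral N u"
    "nn_integral (plus_subspace_measure M N) v = nn_integral M v + nn_integral N v"
    by (rule add.IH)+
  show ?case
    by (simp only: nn_integral_add measurable_plus_subspace_measure uv IH ac_simps)
next
  case (seq U)
  have m: "U i \<in> borel_measurable N" for i
    by (rule measurable_subspace[OF seq.hyps(1)])
  have inc: "incseq (\<lambda>i. nn_integral L (U i))" for L
    by (intro incseq_SucI nn_integral_mono) (rule le_funD, rule incseq_SucD[OF seq.hyps(3)])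
  have sup: "nn_integral L (SUP i. U i) = (SUP i. nn_integral L (U i))"
    if "\<And>i. U i \<in> borel_measurable L" for L :: "'a measure"
  proof -
    have "(SUP i. U i) = (\<lambda>x. SUP i. U i x)" by (rule ext) (rule SUP_apply)
    then show ?thesis
      using nn_integral_monotone_convergence_SUP[OF seq.hyps(3) that] by (simp only:)
  qed
  have "nn_integral (plus_subspace_measure M N) (SUP i. U i)
      = (SUP i. nn_integral M (U i) + nn_integral N (U i))"
    by (subst sup) (simp_all only: measurable_plus_subspace_measure seq.IH seq.hyps(1))
  also have "\<dots> = (SUP i. nn_integral M (U i)) + (SUP i. nn_integral N (U i))"
    by (rule ennreal_SUP_add[OF inc inc])
  also have "\<dots> = nn_integral M (SUP i. U i) + nn_integral N (SUP i. U i)"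
    by (simp only: sup m seq.hyps(1))
  finally show ?case .
qed

lemma integral_plus_subspace_measure:
  fixes f :: "'a \<Rightarrow> real"
  assumes f: "integrable M f" "integrable N f"
  shows "integral\<^sup>L (plus_subspace_measure M N) f = integral\<^sup>L M f + integral\<^sup>L N f"
proof -
  have m: "f \<in> borel_measurable M" using f by auto
  have i: "integrable (plus_subspace_measure M N) f"
    using f m unfolding integrable_iff_bounded
    by (auto simp: nn_integral_plus_subspace_measure)
  show ?thesis
    using f m unfolding real_lebesgue_integral_def[OF i] real_lebesgue_integral_def[OF f(1)]
      real_lebesgue_integral_def[OF f(2)]
    by (simp add: nn_integral_plus_subspace_measure real_integrable_def enn2real_plus less_top)
qed

end

lemma prob_space_normalised_density:
  fixes w :: "'a \<Rightarrow> real"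
  assumes "w \<in> borel_measurable M" "AE x in M. 0 < w x" "W = (\<integral>x. w x \<partial>M)" "0 < W"
  shows "prob_space (density M (\<lambda>x. ennreal (w x / W)))"
proof (rule prob_spaceI)
  \<comment> \<open>A nonzero Bochner integral certifies integrability.\<close>
  have i: "integrable M w" using not_integrable_integral_eq[of M w] assms(3,4) by (cases "integrable M w") auto
  have "emeasure (density M (\<lambda>x. ennreal (w x / W))) (space M) = (\<integral>\<^sup>+x. ennreal (w x / W) \<partial>M)"
    using assms(1) by (simp add: emeasure_density)
  also have "\<dots> = ennreal (\<integral>x. w x / W \<partial>M)"
    using i assms by (intro nn_integral_eq_integral) auto
  also have "\<dots> = 1" using assms by simp
  finally show "emeasure (density M (\<lambda>x. ennreal (w x / W)))
      (space (density M (\<lambda>x. ennreal (w x / W)))) = 1" by simp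
qed

text \<open>
  A positive constant factor in the density comes out of the integral. This is valid even for a
  nonmeasurable \<open>f\<close>, both integrals being \<open>0\<close> then; it is thus available for \<open>grad_sq\<close>, whose
  definition involves an arbitrary choice of chart at every point.
\<close>

lemma integral_density_rescale:
  fixes w f :: "'a \<Rightarrow> real"
  assumes w: "w \<in> borel_measurable M" "AE x in M. 0 < w x" and W: "0 < W"
  shows "(\<integral>x. f x \<partial>density M (\<lambda>x. ennreal (w x))) = W * (\<integral>x. f x \<partial>density M (\<lambda>x. ennreal (w x / W)))"
proof (cases "f \<in> borel_measurable M")
  case True
  then show ?thesis using assms by (subst (1 2) integral_density) (auto)
next
  case False
  then have "\<not> integrable (density M (\<lambda>x. ennreal (w x))) f" "\<not> integrable (density M (\<lambda>x. ennreal (w x / W))) f"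
    by (auto dest!: borel_measurable_integrable)
  then show ?thesis by (simp add: not_integrable_integral_eq)
qed

lemma integrable_density_rescale:
  fixes w f :: "'a \<Rightarrow> real"
  assumes w: "w \<in> borel_measurable M" "AE x in M. 0 < w x" and W: "0 < W"
    and f: "integrable (density M (\<lambda>x. ennreal (w x / W))) f"
  shows "integrable (density M (\<lambda>x. ennreal (w x))) f"
proof -
  have m: "f \<in> borel_measurable M" using borel_measurable_integrable[OF f] by simp
  have "integrable M (\<lambda>x. w x / W * f x)"
    using f w W m by (subst (asm) integrable_density) auto
  then have "integrable M (\<lambda>x. W * (w x / W * f x))" by (rule integrable_mult_right)
  then have "integrable M (\<lambda>x. w x * f x)" using W by simp
  then show ?thesis using w m by (subst integrable_density) auto
qed

section \<open>Measures and functions on the manifold and its boundary\<close>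

lemma
  shows space_hausdorff_measure [simp]: "space (hausdorff_measure \<rho> s X) = X"
    and sets_hausdorff_measure [simp]:
      "sets (hausdorff_measure \<rho> s X) = sets (restrict_space borel X)"
proof -
  have "sets (restrict_space borel X) \<subseteq> Pow X"
    using sets.space_closed[of "restrict_space borel X"] by (simp add: space_restrict_space)
  moreover have "sigma_sets X (sets (restrict_space borel X)) = sets (restrict_space borel X)"
    using sets.sigma_sets_eq[of "restrict_space borel X"] by (simp add: space_restrict_space)
  ultimately show "space (hausdorff_measure \<rho> s X) = X"
    "sets (hausdorff_measure \<rho> s X) = sets (restrict_space borel X)"
    by (simp_all add: hausdorff_measure_def)
qed

lemma points_bdry_subset: "points (bdry \<A>) \<subseteq> points \<A>"
  by (auto simp: points_def bdry_def)

lemma sets_restrict_borel_Int: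
  assumes "Y \<subseteq> X" "E \<in> sets (restrict_space borel X)"
  shows "E \<inter> Y \<in> sets (restrict_space borel Y)"
proof -
  obtain F where "F \<in> sets borel" "E = X \<inter> F"
    using assms(2) by (auto simp: sets_restrict_space)
  then show ?thesis using assms(1) by (auto simp: sets_restrict_space image_iff)
qed

lemma continuous_on_openin_cover:
  fixes f :: "'a::t2_space \<Rightarrow> 'b::topological_space"
  assumes "\<And>x. x \<in> S \<Longrightarrow> \<exists>U. x \<in> U \<and> openin (top_of_set S) U \<and> continuous_on U f"
  shows "continuous_on S f"
  unfolding continuous_on_eq_continuous_within
proof
  fix x assume "x \<in> S"
  then obtain U where U: "x \<in> U" "openin (top_of_set S) U" "continuous_on U f"
    using assms by blast
  then obtain T where T: "open T" "U = S \<inter> T" by (auto simp: openin_open)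
  have "at x within S = at x within U"
    by (rule at_within_nhd[of x T]) (use U T in auto)
  with U show "continuous (at x within S) f"
    by (simp add: continuous_on_eq_continuous_within)
qed

lemma C1_continuous_on:
  fixes \<A> :: "('a::t2_space, 'v::euclidean_space) rchart set"
  assumes "riemannian_atlas H \<A>" "f \<in> C1 \<A>"
  shows "continuous_on (points \<A>) f"
proof (rule continuous_on_openin_cover)
  fix p assume "p \<in> points \<A>"
  then obtain U \<phi> G where c: "(U, \<phi>, G) \<in> \<A>" "p \<in> U" by (auto simp: points_def)
  have U: "openin (top_of_set (points \<A>)) U"
    and hom: "homeomorphism U (\<phi> ` U) \<phi> (inv_into U \<phi>)"
    using assms(1) c by (auto simp: riemannian_atlas_def riemannian_chart_def)
  have "continuous_on (\<phi> ` U) (\<lambda>x. f (inv_into U \<phi> x))"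
  proof -
    have "Ck_on 1 (\<lambda>x. f (inv_into U \<phi> x)) (\<phi> ` U)"
      using assms(2) c(1) unfolding C1_def by blast
    then show ?thesis
      by (auto simp: One_nat_def simp del: image_iff intro: has_derivative_continuous_on)
  qed
  then have "continuous_on U ((\<lambda>x. f (inv_into U \<phi> x)) \<circ> \<phi>)"
    by (rule continuous_on_compose[OF homeomorphism_cont1[OF hom]])
  moreover have "((\<lambda>x. f (inv_into U \<phi> x)) \<circ> \<phi>) q = f q" if "q \<in> U" for q
    by (simp add: homeomorphism_apply1[OF hom that])
  ultimately have "continuous_on U f"
    by (rule continuous_on_eq)
  with U c show "\<exists>U. p \<in> U \<and> openin (top_of_set (points \<A>)) U \<and> continuous_on U f" by blast
qed

lemma grad_sq_nonneg:
  assumes "riemannian_atlas H \<A>" "p \<in> points \<A>"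
  shows "0 \<le> grad_sq \<A> f p"
proof -
  have "\<exists>c. c \<in> \<A> \<and> p \<in> fst c" using assms(2) by (force simp: points_def)
  then have "chart_at \<A> p \<in> \<A> \<and> p \<in> fst (chart_at \<A> p)"
    unfolding chart_at_def by (rule someI_ex)
  then obtain U \<phi> G where c: "chart_at \<A> p = (U, \<phi>, G)" "(U, \<phi>, G) \<in> \<A>" "p \<in> U"
    by (cases "chart_at \<A> p") auto
  then have "bilinear (G p)" "\<And>v. v \<noteq> 0 \<Longrightarrow> 0 < G p v v"
    using assms(1) by (auto simp: riemannian_atlas_def riemannian_chart_def)
  then have "0 \<le> G p v v" for v
    by (cases "v = 0") (auto simp: bilinear_lzero less_imp_le)
  then show ?thesis by (simp add: grad_sq_def metric_at_def c)
qed

section \<open>Optimal constants\<close>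

text \<open>
  An optimal constant is itself admissible. Where the energy \<open>E i\<close> is positive, \<open>V i / E i\<close> is a lower
  bound of all admissible constants; where it is zero, admissibility does not depend on the
  constant, and some constant is admissible since the infimum is not \<open>\<infinity>\<close>.
\<close>

lemma Inf_ereal_multiplier_attained:
  fixes V E :: "'i \<Rightarrow> real"
  assumes fin: "\<bar>Inf {ereal c | c. \<forall>i\<in>I. V i \<le> c * E i}\<bar> \<noteq> \<infinity>"
    and nn: "0 \<le> E i" and i: "i \<in> I"
  shows "V i \<le> real_of_ereal (Inf {ereal c | c. \<forall>i\<in>I. V i \<le> c * E i}) * E i"
proof -
  define X where "X = {ereal c | c. \<forall>i\<in>I. V i \<le> c * E i}"
  obtain c where c: "Inf X = ereal c" using fin unfolding X_def[symmetric] by (cases "Inf X") auto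
  have "V i \<le> c * E i"
  proof (cases "E i = 0")
    case True
    have "X \<noteq> {}" using c by (auto simp: top_ereal_def)
    then show ?thesis using i True by (auto simp: X_def)
  next
    case False
    then have pos: "0 < E i" using nn by simp
    have "ereal (V i / E i) \<le> Inf X"
      by (rule Inf_greatest) (use i pos in \<open>auto simp: X_def divide_le_eq\<close>)
    then show ?thesis using pos by (simp add: c divide_le_eq)
  qed
  then show ?thesis unfolding X_def[symmetric] c by simp
qed

lemma
  assumes energy: "0 \<le> (\<integral>p. grad_sq \<A> f p \<partial>\<eta>)" and f: "f \<in> C1 \<A>"
  shows poincare_const_bound: "\<bar>poincare_const \<A> \<nu> \<eta>\<bar> \<noteq> \<infinity> \<Longrightarrow>
      Var \<nu> f \<le> real_of_ereal (poincare_const \<A> \<nu> \<eta>) * (\<integral>p. grad_sq \<A> f p \<partial>\<eta>)"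
    and log_sobolev_const_bound: "\<bar>log_sobolev_const \<A> \<nu> \<eta>\<bar> \<noteq> \<infinity> \<Longrightarrow>
      Ent \<nu> (\<lambda>p. (f p)\<^sup>2) \<le> real_of_ereal (log_sobolev_const \<A> \<nu> \<eta>) * (\<integral>p. grad_sq \<A> f p \<partial>\<eta>)"
  unfolding poincare_const_def log_sobolev_const_def
  by (rule Inf_ereal_multiplier_attained[where E = "\<lambda>f. \<integral>p. grad_sq \<A> f p \<partial>\<eta>", OF _ energy f],
      assumption)+

section \<open>The logarithmic Sobolev constant of the mixture\<close>

theorem proposition3p2:
  fixes \<A> :: "('a::t2_space, real \<times> 'b::euclidean_space) rchart set"
    and lam \<sigma> lam\<alpha> \<sigma>\<beta> \<mu> :: "'a measure"
    and \<alpha> \<beta> :: "'a \<Rightarrow> real"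
    and A B K\<^sub>b L\<^sub>b K\<^sub>1 :: real
    and d :: nat
  assumes dim: "d = DIM(real \<times> 'b)"
    and manifold: "riemannian_atlas half_space \<A>" "compact (points \<A>)" "connected (points \<A>)"
      "connected (points (bdry \<A>))"
    and lam: "is_volume_measure \<A> lam"
    and \<sigma>: "\<sigma> = surface_measure \<A>"
    and A: "A = (\<integral>p. \<alpha> p \<partial>lam)"
    and B: "B = (\<integral>p. \<beta> p \<partial>\<sigma>)"
    and lam\<alpha>: "lam\<alpha> = density lam (\<lambda>p. ennreal (\<alpha> p / A))"
    and \<sigma>\<beta>: "\<sigma>\<beta> = density \<sigma> (\<lambda>p. ennreal (\<beta> p / B))"
    and \<mu>: "\<mu> = plus_subspace_measure (density lam (\<lambda>p. ennreal (\<alpha> p)))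
                   (density \<sigma> (\<lambda>p. ennreal (\<beta> p)))"
    and prob: "prob_space \<mu>" "0 < A" "A < 1" "0 < B" "B < 1" "A + B = 1"
    and weights: "continuous_on (points \<A>) \<alpha>" "continuous_on (points \<A>) \<beta>"
      "AE p in lam. 0 < \<alpha> p" "AE p in \<sigma>. 0 < \<beta> p"
      "(\<lambda>p. sqrt (\<alpha> p)) \<in> W12 \<A> lam" "(\<lambda>p. sqrt (\<beta> p)) \<in> W12 (bdry \<A>) \<sigma>"
    and finite_consts:
      "\<bar>poincare_const \<A> lam\<alpha> lam\<alpha>\<bar> \<noteq> \<infinity>" "\<bar>log_sobolev_const \<A> lam\<alpha> lam\<alpha>\<bar> \<noteq> \<infinity>"
      "\<bar>poincare_const (bdry \<A>) \<sigma>\<beta> \<sigma>\<beta>\<bar> \<noteq> \<infinity>" "\<bar>log_sobolev_const (bdry \<A>) \<sigma>\<beta> \<sigma>\<beta>\<bar> \<noteq> \<infinity>"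
    and embeddings:
      "compactly_embeds \<A> (density lam (\<lambda>p. ennreal (\<alpha> p))) (density lam (\<lambda>p. ennreal (\<alpha> p)))"
      "\<And>p::real. 2 \<le> p \<Longrightarrow> (2 < d \<Longrightarrow> p \<le> (2 * real d - 2) / (real d - 2)) \<Longrightarrow>
         embeds \<A> (density lam (\<lambda>p. ennreal (\<alpha> p))) p (density lam (\<lambda>p. ennreal (\<beta> p)))"
      "compactly_embeds (bdry \<A>) (density \<sigma> (\<lambda>p. ennreal (\<beta> p))) (density \<sigma> (\<lambda>p. ennreal (\<beta> p)))"
      "compact_trace \<A> (density lam (\<lambda>p. ennreal (\<alpha> p))) (density \<sigma> (\<lambda>p. ennreal (\<beta> p)))"
    and K\<^sub>b: "\<And>f. f \<in> C1 \<A> \<Longrightarrow> Var \<sigma>\<beta> f \<le> K\<^sub>b * (\<integral>p. grad_sq \<A> f p \<partial>lam\<alpha>)"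
    and L\<^sub>b: "\<And>f. f \<in> C1 \<A> \<Longrightarrow> Ent \<sigma>\<beta> (\<lambda>p. (f p)\<^sup>2) \<le> L\<^sub>b * (\<integral>p. grad_sq \<A> f p \<partial>lam\<alpha>)"
    and K\<^sub>1: "\<And>f. f \<in> C1 \<A> \<Longrightarrow>
      ((\<integral>p. f p \<partial>lam\<alpha>) - (\<integral>p. f p \<partial>\<sigma>\<beta>))\<^sup>2 \<le> K\<^sub>1 * (\<integral>p. grad_sq \<A> f p \<partial>lam\<alpha>)"
  shows "log_sobolev_const \<A> \<mu> (density lam (\<lambda>p. ennreal (\<alpha> p)))
    \<le> log_sobolev_const \<A> lam\<alpha> lam\<alpha> + ereal (B / A * L\<^sub>b)
       + ereal (B * log_quotient A B) * (poincare_const \<A> lam\<alpha> lam\<alpha> + ereal (K\<^sub>b + K\<^sub>1))"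
proof -
  let ?\<Omega> = "points \<A>" and ?\<Gamma> = "points (bdry \<A>)"
  let ?M = "density lam (\<lambda>p. ennreal (\<alpha> p))" and ?N = "density \<sigma> (\<lambda>p. ennreal (\<beta> p))"
  define energy where "energy f = (\<integral>p. grad_sq \<A> f p \<partial>lam\<alpha>)" for f
  have lam_sp: "space lam = ?\<Omega>" "sets lam = sets (restrict_space borel ?\<Omega>)"
    using lam by (simp_all add: is_volume_measure_def)
  have \<sigma>_sp: "space \<sigma> = ?\<Gamma>" "sets \<sigma> = sets (restrict_space borel ?\<Gamma>)"
    by (simp_all add: \<sigma> surface_measure_def)
  have meas_lam: "g \<in> borel_measurable lam" if "continuous_on ?\<Omega> g" for g :: "'a \<Rightarrow> real"
    using borel_measurable_continuous_on_restrict[OF that] lam_sp(2)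
    by (simp cong: measurable_cong_sets)
  have meas_\<sigma>: "g \<in> borel_measurable \<sigma>" if "continuous_on ?\<Omega> g" for g :: "'a \<Rightarrow> real"
    using borel_measurable_continuous_on_restrict[OF continuous_on_subset[OF that points_bdry_subset]]
      \<sigma>_sp(2) by (simp cong: measurable_cong_sets)
  note \<alpha> = meas_lam[OF weights(1)] weights(3) and \<beta> = meas_\<sigma>[OF weights(2)] weights(4)
  have probs: "prob_space lam\<alpha>" "prob_space \<sigma>\<beta>"
    unfolding lam\<alpha> \<sigma>\<beta>
    by (rule prob_space_normalised_density[OF \<alpha> A prob(2)],
        rule prob_space_normalised_density[OF \<beta> B prob(4)])
  have sub: "E \<inter> space ?N \<in> sets ?N" if "E \<in> sets ?M" for E
    using sets_restrict_borel_Int[OF points_bdry_subset] that by (simp add: lam_sp \<sigma>_sp)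
  have sp: "space ?N \<subseteq> space ?M" using points_bdry_subset by (simp add: lam_sp \<sigma>_sp)
  have mixture: "(\<integral>p. g p \<partial>\<mu>) = A * (\<integral>p. g p \<partial>lam\<alpha>) + B * (\<integral>p. g p \<partial>\<sigma>\<beta>)"
    if "integrable lam\<alpha> g" "integrable \<sigma>\<beta> g" for g :: "'a \<Rightarrow> real"
  proof -
    have "integrable ?M g" "integrable ?N g"
      using that integrable_density_rescale[OF \<alpha> prob(2)] integrable_density_rescale[OF \<beta> prob(4)]
      unfolding lam\<alpha> \<sigma>\<beta> by blast+
    then have "(\<integral>p. g p \<partial>\<mu>) = (\<integral>p. g p \<partial>?M) + (\<integral>p. g p \<partial>?N)"
      unfolding \<mu> by (intro integral_plus_subspace_measure[OF sp] sub)
    then show ?thesis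
      using integral_density_rescale[OF \<alpha> prob(2), of g] integral_density_rescale[OF \<beta> prob(4), of g]
      unfolding lam\<alpha> \<sigma>\<beta> by simp
  qed
  \<comment> \<open>Without nonnegative energy the optimal constants need not be admissible.\<close>
  have energy_nonneg: "0 \<le> energy f" for f
    unfolding energy_def
    by (rule integral_nonneg_AE, rule AE_I2)
       (use grad_sq_nonneg[OF manifold(1)] in \<open>simp add: lam\<alpha> lam_sp\<close>)
  define c\<^sub>P where "c\<^sub>P = real_of_ereal (poincare_const \<A> lam\<alpha> lam\<alpha>)"
  define c\<^sub>L where "c\<^sub>L = real_of_ereal (log_sobolev_const \<A> lam\<alpha> lam\<alpha>)"
  have P: "poincare_const \<A> lam\<alpha> lam\<alpha> = ereal c\<^sub>P"
    and L: "log_sobolev_const \<A> lam\<alpha> lam\<alpha> = ereal c\<^sub>L"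
    unfolding c\<^sub>P_def c\<^sub>L_def using finite_consts(1,2) by (simp_all add: ereal_real')
  have c\<^sub>P: "Var lam\<alpha> f \<le> c\<^sub>P * energy f"
    and c\<^sub>L: "Ent lam\<alpha> (\<lambda>p. (f p)\<^sup>2) \<le> c\<^sub>L * energy f" if "f \<in> C1 \<A>" for f
    unfolding c\<^sub>P_def c\<^sub>L_def energy_def
    by (rule poincare_const_bound log_sobolev_const_bound; fact energy_nonneg[unfolded energy_def]
        that finite_consts)+
  define q where "q = log_quotient A B"
  define c where "c = c\<^sub>L + B / A * L\<^sub>b + B * q * (c\<^sub>P + (K\<^sub>b + K\<^sub>1))"
  have "Ent \<mu> (\<lambda>p. (f p)\<^sup>2) \<le> c * (\<integral>p. grad_sq \<A> f p \<partial>?M)" if f: "f \<in> C1 \<A>" for f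
  proof -
    have cont: "continuous_on ?\<Omega> f" using C1_continuous_on[OF manifold(1) f] .
    then have "bounded (f ` ?\<Omega>)"
      by (intro compact_imp_bounded compact_continuous_image manifold(2))
    then obtain C where C: "\<And>p. p \<in> ?\<Omega> \<Longrightarrow> \<bar>f p\<bar> \<le> C" by (auto simp: bounded_iff)
    have "Ent \<mu> (\<lambda>p. (f p)\<^sup>2) \<le> A * Ent lam\<alpha> (\<lambda>p. (f p)\<^sup>2) + B * Ent \<sigma>\<beta> (\<lambda>p. (f p)\<^sup>2)
      + A * B * q * (Var lam\<alpha> f + Var \<sigma>\<beta> f + ((\<integral>p. f p \<partial>lam\<alpha>) - (\<integral>p. f p \<partial>\<sigma>\<beta>))\<^sup>2)"
      unfolding q_def
    proof (rule log_sobolev_mixture[OF probs prob(2,4,6)])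
      show "f \<in> borel_measurable lam\<alpha>" "f \<in> borel_measurable \<sigma>\<beta>"
        using meas_lam[OF cont] meas_\<sigma>[OF cont] by (simp_all add: lam\<alpha> \<sigma>\<beta>)
      show "\<bar>f p\<bar> \<le> C" if "p \<in> space lam\<alpha> \<union> space \<sigma>\<beta>" for p
        using that C points_bdry_subset[of \<A>] by (auto simp: lam\<alpha> \<sigma>\<beta> lam_sp \<sigma>_sp)
    qed (rule mixture)
    also have "\<dots> \<le> A * (c\<^sub>L * energy f) + B * (L\<^sub>b * energy f)
      + A * B * q * (c\<^sub>P * energy f + K\<^sub>b * energy f + K\<^sub>1 * energy f)"
      using prob(2,4) log_quotient_pos[OF prob(2,4)]
      by (intro add_mono mult_left_mono c\<^sub>L c\<^sub>P f L\<^sub>b[OF f, folded energy_def]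
          K\<^sub>b[OF f, folded energy_def] K\<^sub>1[OF f, folded energy_def]) (auto simp: q_def)
    also have "\<dots> = c * (A * energy f)"
      using prob(2) by (simp add: c_def field_simps)
    also have "A * energy f = (\<integral>p. grad_sq \<A> f p \<partial>?M)"
      unfolding energy_def lam\<alpha> by (rule integral_density_rescale[OF \<alpha> prob(2), symmetric])
    finally show ?thesis .
  qed
  then have "log_sobolev_const \<A> \<mu> ?M \<le> ereal c"
    unfolding log_sobolev_const_def by (intro Inf_lower) blast
  then show ?thesis by (simp add: P L c_def q_def)
qed

end
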